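(* Let $h>0$, $I=h\mathbb{N}_0$, $T>h$, $r>0$, $K\ge0$, and let $P=(P_t)_{t\in I}$ be the translation-invariant finite-state Markov chain on $\mathbb{R}$ (so $d=1$) with weights $\alpha_i^{(h)}$ and states $x_i^{(h)}$, $i\in\{1,\dots,m\}$. Let $\bar f=\exp$ and $g=K-\bar f$. Under these assumptions there is a $\gamma_1$ such that $P_t\bar f=\gamma_1^t\bar f$ for all $t\in I$; suppose that $\gamma_1\in(0,e^r]$. Assume, moreover, that $x_i^{(h)}\le0$ for all $i\in\{1,\dots,m\}$. Then there exists a real number $D>0$ such that for all $N>M\in\mathbb{N}$, all $s\in(0,T]\cap(2^N\cdot I)$ and all monotonely decreasing $f\ge g\vee0$, $$\left\|(B_{s\cdot2^{-N}})^{\circ(2^N)}f-(B_{s\cdot2^{-M}})^{\circ(2^M)}f\right\|_{L^1(E^h)}\le D\cdot s^2\cdot2^{-M}\left(1-2^{-(N-M-1)}\right)\le D\cdot s^2\cdot2^{-M}.$$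
   Context: The chain: $P_hf=\sum_{i=1}^m\alpha_i^{(h)}f(\cdot-x_i^{(h)})$ with $\alpha_i^{(h)}\in(0,1]$, $\sum_i\alpha_i^{(h)}=1$, and $P_{nh}=(P_h)^{\circ n}$; for $t\in I$ one writes $P_tf=\sum_{i=1}^{m^{t/h}}\alpha_i^{(t)}f(\cdot-x_i^{(t)})$, where the $x_i^{(t)}$ (assumed distinct) are the states at time $t$ of the chain started in $0$, i.e. the sums of $t/h$ of the $x_i^{(h)}$, and $\alpha_i^{(t)}\in(0,1]$ are the corresponding weights. For $t\in I$, $B_tf:=(e^{-rt}P_tf)\vee g$ for nonnegative measurable $f$; $B^{\circ n}$ denotes $n$-fold composition. $E^h:=\{x: P_h(g\vee0)(x)>P_hg(x)\}$. $L^1(E^h)$ is with respect to Lebesgue measure restricted to $E^h$; norms may take the value $+\infty$. $2^N\cdot I=\{2^Nt:t\in I\}$. All functions are measurable.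
   Formalization: For N = M+1 the printed middle bound equals 0 and the first inequality is false in general; the formal theorem asserts the middle bound only for N > M+1, and the outer bound D s² 2^{-M} for all N > M. *)

theory Defs
  imports "HOL-Analysis.Analysis"
begin

definition time_grid :: "real \<Rightarrow> real set" where
  "time_grid h = {real n * h | n. True}"

definition chain_step ::
    "nat \<Rightarrow> (nat \<Rightarrow> real) \<Rightarrow> (nat \<Rightarrow> real) \<Rightarrow> (real \<Rightarrow> real) \<Rightarrow> real \<Rightarrow> real" where
  "chain_step m \<alpha> x f = (\<lambda>y. \<Sum>i=1..m. \<alpha> i * f (y - x i))"

text \<open>The semigroup \<open>P\<^sub>t\<close>. It is only meaningful for \<open>t\<close> in \<^term>\<open>time_grid h\<close>, where
  \<open>t / h\<close> is a natural number, so that rounding down is exact.\<close>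
definition chain ::
    "real \<Rightarrow> nat \<Rightarrow> (nat \<Rightarrow> real) \<Rightarrow> (nat \<Rightarrow> real) \<Rightarrow> real \<Rightarrow> (real \<Rightarrow> real) \<Rightarrow> real \<Rightarrow> real" where
  "chain h m \<alpha> x t = chain_step m \<alpha> x ^^ nat \<lfloor>t / h\<rfloor>"

text \<open>For \<open>P = chain h m \<alpha> x\<close>, this is the operator \<open>B\<^sub>t\<close>.\<close>
definition bermudan ::
    "(real \<Rightarrow> (real \<Rightarrow> real) \<Rightarrow> real \<Rightarrow> real) \<Rightarrow> real \<Rightarrow> (real \<Rightarrow> real) \<Rightarrow>
     real \<Rightarrow> (real \<Rightarrow> real) \<Rightarrow> real \<Rightarrow> real" where
  "bermudan P r g t f = (\<lambda>y. max (exp (- r * t) * P t f y) (g y))"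

definition critical_set ::
    "(real \<Rightarrow> (real \<Rightarrow> real) \<Rightarrow> real \<Rightarrow> real) \<Rightarrow> (real \<Rightarrow> real) \<Rightarrow> real \<Rightarrow> real set" where
  "critical_set P g h = {y. P h (\<lambda>z. max (g z) 0) y > P h g y}"

text \<open>The \<open>L\<^sup>1\<close>-norm with respect to Lebesgue measure on a set, with values in \<open>[0, \<infinity>]\<close>.\<close>
definition L1_norm_on :: "real set \<Rightarrow> (real \<Rightarrow> real) \<Rightarrow> ennreal" where
  "L1_norm_on S f = (\<integral>\<^sup>+y\<in>S. ennreal \<bar>f y\<bar> \<partial>lborel)"

text \<open>The source bounds the distance between level \<open>N\<close> and level \<open>M\<close> by
  \<open>D s\<^sup>2 2\<^sup>-\<^sup>M (1 - 2\<^sup>-\<^sup>(\<^sup>N\<^sup>-\<^sup>M\<^sup>-\<^sup>1\<^sup>))\<close>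
  for all \<open>N > M\<close>. For \<open>N = M + 1\<close> this bound is \<open>0\<close> and the claim is false, for example
  for three states \<open>0, -1, -2\<close> of weight \<open>1/3\<close> with \<open>h = K = 1\<close> and \<open>exp r = \<gamma>\<^sub>1\<close>. The theorem
  therefore asserts that bound for \<open>N > M + 1\<close>, and the bound \<open>D s\<^sup>2 2\<^sup>-\<^sup>M\<close> for all
  \<open>N > M\<close>.\<close>

end

theory Submission
  imports Defs
begin

text \<open>Write \<open>u\<^sup>+\<close> for \<open>max u 0\<close>. The proof compares both iterated Bermudan prices with one and the
  same quantity, the discounted expectation \<open>exp (- r * s) * P s f\<close> of the final payoff, which by
  the semigroup property does not depend on how finely \<open>[0, s]\<close> is divided.

  Since all \<open>x i \<le> 0\<close>, the chain only moves to the right, so the prices at a point \<open>y\<close> are determined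
  by \<open>f\<close> and \<open>g\<close> on \<open>{y..}\<close>. There \<open>g \<le> (g y)\<^sup>+\<close>, because \<open>g\<close> is decreasing, and hence each early
  exercise date raises the price at \<open>y\<close> by at least \<open>0\<close> and at most \<open>(g y)\<^sup>+\<close>
  (lemma \<open>bermudan_iterate_bounds\<close>). Consequently the two prices in the theorem, which have \<open>2 ^ N\<close>
  and \<open>2 ^ M\<close> exercise dates, differ at \<open>y\<close> by at most \<open>2 ^ N * (g y)\<^sup>+\<close>, for every \<open>f \<ge> 0\<close>.

  The integral of \<open>g\<^sup>+\<close> over the critical set is finite: a critical point can jump into the region
  \<open>{g < 0}\<close> in one step, so if \<open>g\<close> is positive at this point, then its distance from the zero \<open>ln K\<close>
  of \<open>g\<close> is less than the largest jump length (lemma \<open>L1_norm_on_critical_set_le\<close>). The error is therefore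
  at most \<open>2 ^ N * C\<close> for a constant \<open>C\<close>.

  Finally, the exercise dates lie on the grid, so \<open>s / 2 ^ N \<ge> h\<close>, and this turns a bound that
  grows with \<open>N\<close> into the asserted one: as \<open>M \<le> N\<close>,
  \<open>2 ^ N * h\<^sup>2 \<le> (2 ^ N * h)\<^sup>2 / 2 ^ M \<le> s\<^sup>2 / 2 ^ M\<close>. The factor \<open>1 - 1 / 2 ^ (N - M - 1)\<close> is at least
  \<open>1/2\<close> for \<open>N > M + 1\<close>, so every \<open>D > 0\<close> with \<open>D \<ge> 2 * C / h\<^sup>2\<close> will do.\<close>

lemma chain_grid:
  assumes "h > 0"
  shows "chain h m \<alpha> x (real n * h) = chain_step m \<alpha> x ^^ n"
  using assms by (simp add: chain_def)

text \<open>A translation multiplies \<open>exp\<close> by a constant, so \<open>exp\<close> is an eigenfunction of every average of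
  translations.\<close>

lemma chain_step_exp_iterate:
  "(chain_step m \<alpha> x ^^ n) exp = (\<lambda>y. (\<Sum>i=1..m. \<alpha> i * exp (- x i)) ^ n * exp y)"
proof (induction n)
  case (Suc n)
  then show ?case
    by (auto simp: chain_step_def sum_distrib_left sum_distrib_right exp_diff exp_minus field_simps
        intro!: sum.cong)
qed auto

lemma chain_exp_eigenfunction:
  assumes "h > 0" and "\<forall>i\<in>{1..m}. 0 < \<alpha> i" and "(\<Sum>i=1..m. \<alpha> i) = 1"
  shows "\<exists>\<gamma>>0. \<forall>t\<in>time_grid h. chain h m \<alpha> x t exp = (\<lambda>y. \<gamma> powr t * exp y)"
proof -
  define c where "c = (\<Sum>i=1..m. \<alpha> i * exp (- x i))"
  have "{1..m} \<noteq> {}"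
    using assms(3) by (metis sum.empty zero_neq_one)
  then have c: "c > 0"
    unfolding c_def using assms(2) by (intro sum_pos) auto
  have "chain h m \<alpha> x t exp = (\<lambda>y. (c powr (1 / h)) powr t * exp y)" if t: "t \<in> time_grid h" for t
  proof -
    obtain n where "t = real n * h"
      using t by (auto simp: time_grid_def)
    then show ?thesis
      using assms(1) c
      by (simp only: chain_grid chain_step_exp_iterate flip: c_def) (simp add: powr_powr powr_realpow)
  qed
  then show ?thesis
    using c by (intro exI[of _ "c powr (1 / h)"]) auto
qed

text \<open>As the chain only moves to the right, comparisons need only be known on a half-line; this is
  what makes all later estimates local in \<open>y\<close>.\<close>

lemma chain_step_iterate_mono:
  assumes "\<forall>i\<in>{1..m}. 0 \<le> \<alpha> i" and "\<forall>i\<in>{1..m}. x i \<le> 0"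
    and "\<forall>z\<ge>b. u z \<le> v z" and "z \<ge> b"
  shows "(chain_step m \<alpha> x ^^ n) u z \<le> (chain_step m \<alpha> x ^^ n) v z"
  using assms(4)
proof (induction n arbitrary: z)
  case (Suc n)
  have "\<alpha> i * (chain_step m \<alpha> x ^^ n) u (z - x i) \<le> \<alpha> i * (chain_step m \<alpha> x ^^ n) v (z - x i)"
    if "i \<in> {1..m}" for i
    using assms(1,2) that Suc by (intro mult_left_mono Suc.IH) fastforce+
  then show ?case
    unfolding funpow.simps comp_def by (subst (1 2) chain_step_def) (rule sum_mono)
qed (use assms(3) in auto)

lemma chain_step_iterate_affine:
  assumes "(\<Sum>i=1..m. \<alpha> i) = 1"
  shows "(chain_step m \<alpha> x ^^ n) (\<lambda>y. a * u y + c) = (\<lambda>y. a * (chain_step m \<alpha> x ^^ n) u y + c)"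
proof (induction n)
  case (Suc n)
  have "(\<Sum>i=1..m. \<alpha> i * c) = c"
    using assms by (simp flip: sum_distrib_right)
  then show ?case
    using Suc by (simp add: chain_step_def distrib_left sum.distrib sum_distrib_left mult.left_commute)
qed auto

lemma chain_step_iterate_nonneg:
  assumes "\<forall>i\<in>{1..m}. 0 \<le> \<alpha> i" and "\<forall>i\<in>{1..m}. x i \<le> 0"
    and "(\<Sum>i=1..m. \<alpha> i) = 1"
    and "\<forall>z\<ge>b. 0 \<le> u z" and "z \<ge> b"
  shows "0 \<le> (chain_step m \<alpha> x ^^ n) u z"
  using chain_step_iterate_mono[OF assms(1,2), of b "\<lambda>y. 0 * u y + 0" u z n] assms(4,5)
  unfolding chain_step_iterate_affine[OF assms(3)] by simp

text \<open>A single exercise date changes a price \<open>p \<ge> 0\<close> into \<open>max p (g z)\<close>, which lies between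
  \<open>p\<close> and \<open>p + \<kappa>\<close>. Averaging and discounting do not enlarge an excess over the
  discounted expectation, so the excesses of the \<open>n\<close> dates at most add up. For \<open>\<kappa> = 0\<close> the bounds
  coincide: where the chain can only see nonpositive values of \<open>g\<close>, exercise is never profitable.\<close>

lemma bermudan_iterate_bounds:
  fixes h r \<kappa> b :: real and \<alpha> x :: "nat \<Rightarrow> real" and k m :: nat
  defines "t \<equiv> real k * h"
  defines "S \<equiv> chain_step m \<alpha> x"
  assumes "h > 0" and "r > 0"
    and \<alpha>: "\<forall>i\<in>{1..m}. 0 \<le> \<alpha> i" and x: "\<forall>i\<in>{1..m}. x i \<le> 0" and sum: "(\<Sum>i=1..m. \<alpha> i) = 1"
    and "\<kappa> \<ge> 0" and g: "\<forall>z\<ge>b. g z \<le> \<kappa>" and f: "\<forall>z\<ge>b. 0 \<le> f z" and "z \<ge> b"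
  shows "exp (- r * (n * t)) * (S ^^ (n * k)) f z \<le> (bermudan (chain h m \<alpha> x) r g t ^^ n) f z
    \<and> (bermudan (chain h m \<alpha> x) r g t ^^ n) f z \<le> exp (- r * (n * t)) * (S ^^ (n * k)) f z + n * \<kappa>"
  using \<open>z \<ge> b\<close>
proof (induction n arbitrary: z)
  case (Suc n)
  define e where "e = exp (- r * t)"
  define a where "a = exp (- r * (n * t))"
  define u where "u = (bermudan (chain h m \<alpha> x) r g t ^^ n) f"
  define v where "v = (S ^^ (n * k)) f"
  have e: "0 < e" "e \<le> 1"
    using \<open>h > 0\<close> \<open>r > 0\<close> by (auto simp: e_def t_def)
  have a_Suc: "exp (- r * (Suc n * t)) = e * a"
    by (simp add: a_def e_def algebra_simps flip: exp_add)
  have v_Suc: "(S ^^ (Suc n * k)) f = (S ^^ k) v"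
    by (simp add: v_def funpow_add)
  have step: "(bermudan (chain h m \<alpha> x) r g t ^^ Suc n) f z = max (e * (S ^^ k) u z) (g z)"
    unfolding t_def u_def e_def
    by (simp add: bermudan_def chain_grid[OF \<open>h > 0\<close>] S_def)
  \<comment> \<open>The summand \<open>0\<close> gives both bounds the affine form that \<open>S\<close> commutes with.\<close>
  have IH: "\<forall>z\<ge>b. a * v z + 0 \<le> u z" "\<forall>z\<ge>b. u z \<le> a * v z + n * \<kappa>"
    using Suc.IH by (auto simp: a_def u_def v_def)
  have lower: "a * (S ^^ k) v z \<le> (S ^^ k) u z"
    using chain_step_iterate_mono[OF \<alpha> x IH(1) Suc.prems, of k]
    unfolding S_def chain_step_iterate_affine[OF sum] by simp
  have upper: "(S ^^ k) u z \<le> a * (S ^^ k) v z + n * \<kappa>"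
    using chain_step_iterate_mono[OF \<alpha> x IH(2) Suc.prems, of k]
    unfolding S_def chain_step_iterate_affine[OF sum] by simp
  have nonneg: "0 \<le> e * (a * (S ^^ k) v z)"
    using chain_step_iterate_nonneg[OF \<alpha> x sum f Suc.prems, of "Suc n * k"] e(1)
    by (simp add: a_def flip: v_Suc S_def)
  have "e * (S ^^ k) u z \<le> e * (a * (S ^^ k) v z + n * \<kappa>)"
    using upper e(1) by (intro mult_left_mono) auto
  also have "\<dots> \<le> e * (a * (S ^^ k) v z) + n * \<kappa>"
    using e \<open>\<kappa> \<ge> 0\<close> by (simp add: distrib_left mult_left_le_one_le)
  finally have upper': "e * (S ^^ k) u z \<le> e * (a * (S ^^ k) v z) + n * \<kappa>" .
  have "0 \<le> n * \<kappa>"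
    using \<open>\<kappa> \<ge> 0\<close> by simp
  moreover have "g z \<le> \<kappa>"
    using g Suc.prems by blast
  moreover have "e * (a * (S ^^ k) v z) \<le> e * (S ^^ k) u z"
    using lower e(1) by (intro mult_left_mono) auto
  ultimately show ?case
    unfolding step a_Suc v_Suc using upper' nonneg \<open>\<kappa> \<ge> 0\<close>
    by (simp add: distrib_right mult.assoc max_def)
qed auto

text \<open>Both prices lie above the same discounted expectation, by at most \<open>2 ^ N * max (g y) 0\<close>, and
  this expectation cancels from their difference; hence the bound is uniform in \<open>f\<close>.\<close>

lemma bermudan_refinement_error:
  assumes "h > 0" and "r > 0"
    and "\<forall>i\<in>{1..m}. 0 \<le> \<alpha> i" and "\<forall>i\<in>{1..m}. x i \<le> 0" and "(\<Sum>i=1..m. \<alpha> i) = 1"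
    and "antimono g" and f: "\<forall>y. 0 \<le> f y" and "M \<le> N" and s: "s = 2 ^ N * (real k * h)"
  shows "\<bar>(bermudan (chain h m \<alpha> x) r g (s / 2 ^ N) ^^ (2 ^ N)) f y
      - (bermudan (chain h m \<alpha> x) r g (s / 2 ^ M) ^^ (2 ^ M)) f y\<bar> \<le> 2 ^ N * max (g y) 0"
    (is "\<bar>?p N - ?p M\<bar> \<le> _")
proof -
  define q where "q = exp (- r * s) * (chain_step m \<alpha> x ^^ (2 ^ N * k)) f y"
  have bounds: "q \<le> ?p L \<and> ?p L \<le> q + 2 ^ N * max (g y) 0" if "L \<le> N" for L
  proof -
    have pow: "(2::'b::{comm_semiring_1}) ^ N = 2 ^ L * 2 ^ (N - L)"
      using that by (simp flip: power_add)
    have t: "s / 2 ^ L = real (2 ^ (N - L) * k) * h"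
      unfolding s pow by simp
    have "\<forall>z\<ge>y. g z \<le> max (g y) 0"
      using \<open>antimono g\<close> by (auto simp: antimono_def le_max_iff_disj)
    from bermudan_iterate_bounds[OF assms(1-5) _ this, of f y "2 ^ L" "2 ^ (N - L) * k"] f
    have "q \<le> ?p L \<and> ?p L \<le> q + 2 ^ L * max (g y) 0"
      unfolding q_def t[symmetric] by (simp add: pow mult.assoc)
    moreover have "2 ^ L * max (g y) 0 \<le> 2 ^ N * max (g y) 0"
      using that by (intro mult_right_mono) auto
    ultimately show ?thesis
      by linarith
  qed
  show ?thesis
    using bounds[of N] bounds[of M] \<open>M \<le> N\<close> by linarith
qed

lemma critical_set_chainD:
  assumes "h > 0" and "y \<in> critical_set (chain h m \<alpha> x) g h"
  obtains i where "i \<in> {1..m}" and "g (y - x i) < 0"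
proof -
  have "chain h m \<alpha> x h = chain_step m \<alpha> x"
    using chain_grid[OF assms(1), of m \<alpha> x 1] by simp
  then have "(\<Sum>i=1..m. \<alpha> i * max (g (y - x i)) 0) \<noteq> (\<Sum>i=1..m. \<alpha> i * g (y - x i))"
    using assms(2) by (simp add: critical_set_def chain_step_def)
  then have "\<exists>i\<in>{1..m}. g (y - x i) < 0"
    by (metis (no_types, lifting) max.absorb1 not_le sum.cong)
  then show ?thesis
    using that by blast
qed

text \<open>At a critical point \<open>y\<close> with \<open>g y > 0\<close> some jump crosses the zero \<open>ln K\<close> of \<open>g\<close>. The sum of all
  jump lengths bounds the largest one, so such points lie in an interval of that length, and
  on it \<open>max (g y) 0 \<le> K\<close>.\<close>

lemma L1_norm_on_critical_set_le:
  fixes g u :: "real \<Rightarrow> real" and K :: real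
  defines "g \<equiv> \<lambda>y. K - exp y"
  assumes "h > 0" and "K \<ge> 0" and "c \<ge> 0"
    and u: "\<And>y. \<bar>u y\<bar> \<le> c * max (g y) 0"
  shows "L1_norm_on (critical_set (chain h m \<alpha> x) g h) u \<le> ennreal (c * (K * (\<Sum>i=1..m. \<bar>x i\<bar>)))"
proof -
  define l where "l = (\<Sum>i=1..m. \<bar>x i\<bar>)"
  define J where "J = {ln K - l..ln K}"
  have l: "l \<ge> 0"
    by (simp add: l_def sum_nonneg)
  have "ennreal \<bar>u y\<bar> * indicator (critical_set (chain h m \<alpha> x) g h) y
      \<le> ennreal (c * K) * indicator J y" for y
  proof (cases "y \<in> critical_set (chain h m \<alpha> x) g h \<and> g y > 0")
    case True
    obtain i where i: "i \<in> {1..m}" "g (y - x i) < 0"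
      using critical_set_chainD \<open>h > 0\<close> True by blast
    have "K > 0"
      using True exp_gt_zero[of y] unfolding g_def by linarith
    have "exp y < exp (ln K)" "exp (ln K) < exp (y - x i)"
      using True i(2) \<open>K > 0\<close> by (simp_all add: g_def)
    then have "y < ln K" "ln K < y - x i"
      by (simp_all only: exp_less_cancel_iff)
    have "\<bar>x i\<bar> \<le> l"
      unfolding l_def using i(1) by (intro member_le_sum) auto
    then have "y \<in> J"
      using \<open>y < ln K\<close> \<open>ln K < y - x i\<close> by (auto simp: J_def)
    moreover have "\<bar>u y\<bar> \<le> c * K"
    proof -
      have "c * max (g y) 0 \<le> c * K"
        using \<open>K \<ge> 0\<close> \<open>c \<ge> 0\<close> by (intro mult_left_mono) (auto simp: g_def)
      then show ?thesis
        using u[of y] by linarith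
    qed
    ultimately show ?thesis
      using True by (simp add: ennreal_leI)
  next
    case False
    then have "u y = 0" if "y \<in> critical_set (chain h m \<alpha> x) g h"
      using u[of y] that by (simp add: max_def split: if_splits)
    then show ?thesis
      by (auto simp: indicator_def)
  qed
  then have "L1_norm_on (critical_set (chain h m \<alpha> x) g h) u
      \<le> (\<integral>\<^sup>+y. ennreal (c * K) * indicator J y \<partial>lborel)"
    unfolding L1_norm_on_def by (intro nn_integral_mono)
  also have "\<dots> = ennreal (c * K) * ennreal l"
    using l by (simp add: J_def nn_integral_cmult_indicator)
  also have "\<dots> = ennreal (c * (K * l))"
    using l assms by (simp add: mult.assoc flip: ennreal_mult')
  finally show ?thesis
    by (simp add: l_def)
qed

theorem theorem7p2:
  fixes h T r K :: real and m :: nat and \<alpha> x :: "nat \<Rightarrow> real"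
    and P :: "real \<Rightarrow> (real \<Rightarrow> real) \<Rightarrow> real \<Rightarrow> real"
    and g :: "real \<Rightarrow> real"
  assumes "h > 0" and "T > h" and "r > 0" and "K \<ge> 0"
    and "\<forall>i\<in>{1..m}. 0 < \<alpha> i \<and> \<alpha> i \<le> 1"
    and "(\<Sum>i=1..m. \<alpha> i) = 1"
    and "inj_on x {1..m}"
    and "\<forall>i\<in>{1..m}. x i \<le> 0"
    and "P = chain h m \<alpha> x"
    and "g = (\<lambda>y. K - exp y)"
  shows
    "(\<exists>\<gamma>\<^sub>1>0. \<forall>t\<in>time_grid h. P t exp = (\<lambda>y. \<gamma>\<^sub>1 powr t * exp y)) \<and>
     (\<forall>\<gamma>\<^sub>1. (\<forall>t\<in>time_grid h. P t exp = (\<lambda>y. \<gamma>\<^sub>1 powr t * exp y)) \<longrightarrow> \<gamma>\<^sub>1 \<in> {0<..exp r} \<longrightarrow>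
       (\<exists>D>0. \<forall>(N::nat) (M::nat) s f.
          N > M \<longrightarrow> s \<in> {0<..T} \<inter> (\<lambda>t. 2 ^ N * t) ` time_grid h \<longrightarrow>
          antimono f \<longrightarrow> (\<forall>y. f y \<ge> max (g y) 0) \<longrightarrow>
          (let err = L1_norm_on (critical_set P g h)
                 (\<lambda>y. (bermudan P r g (s / 2 ^ N) ^^ (2 ^ N)) f y
                     - (bermudan P r g (s / 2 ^ M) ^^ (2 ^ M)) f y);
               bound = D * s\<^sup>2 / 2 ^ M * (1 - 1 / 2 ^ (N - M - 1))
           in (N > M + 1 \<longrightarrow> err \<le> ennreal bound) \<and>
              err \<le> ennreal (D * s\<^sup>2 / 2 ^ M) \<and>
              bound \<le> D * s\<^sup>2 / 2 ^ M)))"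
proof -
  define C where "C = K * (\<Sum>i=1..m. \<bar>x i\<bar>)"
  \<comment> \<open>Adding \<open>1\<close> keeps \<open>D\<close> positive when \<open>C = 0\<close>.\<close>
  define D where "D = 2 * (C + 1) / h\<^sup>2"
  have \<alpha>: "\<forall>i\<in>{1..m}. 0 < \<alpha> i" "\<forall>i\<in>{1..m}. 0 \<le> \<alpha> i"
    using \<open>\<forall>i\<in>{1..m}. 0 < \<alpha> i \<and> \<alpha> i \<le> 1\<close> by auto
  have C: "C \<ge> 0"
    using \<open>K \<ge> 0\<close> by (simp add: C_def sum_nonneg)
  have D: "D > 0"
    using C \<open>h > 0\<close> by (simp add: D_def)
  have "antimono g"
    by (simp add: antimono_def \<open>g = _\<close>)
  have bound:
    "let err = L1_norm_on (critical_set P g h)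
           (\<lambda>y. (bermudan P r g (s / 2 ^ N) ^^ (2 ^ N)) f y
               - (bermudan P r g (s / 2 ^ M) ^^ (2 ^ M)) f y);
         bound = D * s\<^sup>2 / 2 ^ M * (1 - 1 / 2 ^ (N - M - 1))
     in (N > M + 1 \<longrightarrow> err \<le> ennreal bound) \<and>
        err \<le> ennreal (D * s\<^sup>2 / 2 ^ M) \<and>
        bound \<le> D * s\<^sup>2 / 2 ^ M"
    if "N > M" and s: "s \<in> {0<..T} \<inter> (\<lambda>t. 2 ^ N * t) ` time_grid h"
      and f: "\<forall>y. f y \<ge> max (g y) 0" for N M :: nat and s f
  proof -
    let ?err = "L1_norm_on (critical_set P g h)
      (\<lambda>y. (bermudan P r g (s / 2 ^ N) ^^ (2 ^ N)) f y
          - (bermudan P r g (s / 2 ^ M) ^^ (2 ^ M)) f y)"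
    obtain k where k: "s = 2 ^ N * (real k * h)"
      using s by (auto simp: time_grid_def)
    have err: "?err \<le> ennreal (2 ^ N * C)"
      unfolding C_def \<open>P = _\<close> \<open>g = _\<close>
    proof (rule L1_norm_on_critical_set_le)
      fix y
      show "\<bar>(bermudan (chain h m \<alpha> x) r (\<lambda>y. K - exp y) (s / 2 ^ N) ^^ (2 ^ N)) f y
          - (bermudan (chain h m \<alpha> x) r (\<lambda>y. K - exp y) (s / 2 ^ M) ^^ (2 ^ M)) f y\<bar>
        \<le> 2 ^ N * max (K - exp y) 0"
        using bermudan_refinement_error[OF \<open>h > 0\<close> \<open>r > 0\<close> \<alpha>(2) \<open>\<forall>i\<in>{1..m}. x i \<le> 0\<close>
            \<open>(\<Sum>i=1..m. \<alpha> i) = 1\<close> \<open>antimono g\<close> _ _ k, of f M y] f \<open>N > M\<close>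
        by (simp add: \<open>g = _\<close>)
    qed (use \<open>h > 0\<close> \<open>K \<ge> 0\<close> in auto)
    have "k \<noteq> 0"
      using s k by (intro notI) auto
    then have "2 ^ N * h \<le> s"
      using \<open>h > 0\<close> by (simp add: k)
    then have "(2 ^ N * h)\<^sup>2 \<le> s\<^sup>2"
      using \<open>h > 0\<close> by (intro power_mono) auto
    moreover have "2 ^ N * h\<^sup>2 * 2 ^ M \<le> (2 ^ N * h)\<^sup>2"
      using \<open>N > M\<close> \<open>h > 0\<close> by (simp add: power_mult_distrib power2_eq_square[of "2 ^ N"])
    ultimately have "2 ^ N * h\<^sup>2 \<le> s\<^sup>2 / 2 ^ M"
      by (simp add: field_simps)
    then have "D * (2 ^ N * h\<^sup>2) \<le> D * (s\<^sup>2 / 2 ^ M)"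
      using D by (intro mult_left_mono) auto
    moreover have "D * (2 ^ N * h\<^sup>2) = 2 * (2 ^ N * C) + 2 * 2 ^ N"
      using \<open>h > 0\<close> by (simp add: D_def field_simps)
    moreover have "(0::real) < 2 ^ N"
      by simp
    ultimately have half: "2 * (2 ^ N * C) \<le> D * s\<^sup>2 / 2 ^ M"
      unfolding times_divide_eq_right by linarith
    have "0 \<le> 2 ^ N * C"
      using C by simp
    with half have le: "2 ^ N * C \<le> D * s\<^sup>2 / 2 ^ M"
      by linarith
    have refined: "2 ^ N * C \<le> D * s\<^sup>2 / 2 ^ M * (1 - 1 / 2 ^ (N - M - 1))" if "N > M + 1"
    proof -
      have "(2::real) ^ 1 \<le> 2 ^ (N - M - 1)"
        using that by (intro power_increasing) auto
      then have "(1::real) / 2 \<le> 1 - 1 / 2 ^ (N - M - 1)"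
        by (simp add: field_simps)
      then have "D * s\<^sup>2 / 2 ^ M * (1 / 2) \<le> D * s\<^sup>2 / 2 ^ M * (1 - 1 / 2 ^ (N - M - 1))"
        using D by (intro mult_left_mono) auto
      moreover have "2 ^ N * C \<le> D * s\<^sup>2 / 2 ^ M * (1 / 2)"
        using half by simp
      ultimately show ?thesis
        by (rule order_trans[rotated])
    qed
    have "D * s\<^sup>2 / 2 ^ M * (1 - 1 / 2 ^ (N - M - 1)) \<le> D * s\<^sup>2 / 2 ^ M"
      using D by (intro mult_right_le_one_le) auto
    then show ?thesis
      unfolding Let_def using order_trans[OF err ennreal_leI] le refined by blast
  qed
  have "\<exists>\<gamma>\<^sub>1>0. \<forall>t\<in>time_grid h. P t exp = (\<lambda>y. \<gamma>\<^sub>1 powr t * exp y)"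
    unfolding \<open>P = _\<close>
    using \<open>h > 0\<close> \<alpha>(1) \<open>(\<Sum>i=1..m. \<alpha> i) = 1\<close> by (rule chain_exp_eigenfunction)
  then show ?thesis
    using D bound by blast
qed

end
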